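(* Let $\alpha \ge 1$ be an integer and let $G$ be a graph with $\alpha(G) \le \alpha$ and order $n \ge \alpha$. Then \[ \Gamma_d(G) \le \alpha\left(1 + 2\ln(n/\alpha)\right). \]
   Context: $\alpha(G)$ is the independence number of $G$; $\ln$ is the natural logarithm. For a digraph $D$, a directed dominating set is a set $S \subseteq V(D)$ such that every vertex $u \notin S$ has an in-neighbor in $S$ (a vertex $v \in S$ with arc $(v,u)$). $\gamma(D)$ is the minimum size of a directed dominating set of $D$. For a graph $G$, $\Gamma_d(G) = \max\{\gamma(D) : D \text{ an orientation of } G\}$, where an orientation assigns a direction to each edge of $G$. *)

theory Defs
  imports Complex_Main "Graph_Theory.Graph_Theory"
begin

text \<open>
  A finite simple graph is a \<open>pair_graph\<close>: an edge \<open>uv\<close> is represented by the two arcs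
  \<open>(u,v)\<close> and \<open>(v,u)\<close>. A digraph is a plain \<open>pair_pre_digraph\<close>.
\<close>

definition independent_set :: "'a pair_pre_digraph \<Rightarrow> 'a set \<Rightarrow> bool" where
  "independent_set G S \<longleftrightarrow> S \<subseteq> pverts G \<and> (\<forall>u\<in>S. \<forall>v\<in>S. (u, v) \<notin> parcs G)"

definition independence_number :: "'a pair_pre_digraph \<Rightarrow> nat" where
  "independence_number G = Max {card S |S. independent_set G S}"

definition directed_dominating_set :: "'a pair_pre_digraph \<Rightarrow> 'a set \<Rightarrow> bool" where
  "directed_dominating_set D S \<longleftrightarrow>
     S \<subseteq> pverts D \<and> (\<forall>u \<in> pverts D - S. \<exists>v\<in>S. (v, u) \<in> parcs D)"

definition directed_domination_number :: "'a pair_pre_digraph \<Rightarrow> nat" where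
  "directed_domination_number D = Min {card S |S. directed_dominating_set D S}"

text \<open>An orientation keeps exactly one of the two arcs representing each edge.\<close>

definition orientation :: "'a pair_pre_digraph \<Rightarrow> 'a pair_pre_digraph \<Rightarrow> bool" where
  "orientation G D \<longleftrightarrow>
     pverts D = pverts G \<and> parcs D \<subseteq> parcs G \<and>
     (\<forall>(u, v) \<in> parcs G. (u, v) \<in> parcs D \<longleftrightarrow> (v, u) \<notin> parcs D)"

definition upper_directed_domination_number :: "'a pair_pre_digraph \<Rightarrow> nat" where
  "upper_directed_domination_number G =
     Max {directed_domination_number D |D. orientation G D}"

end

theory Submission
  imports Defs
begin

text \<open>
  In every vertex set of an oriented graph of maximum out-degree \<open>d\<close> some vertex has in-degree at
  most the average, hence total degree at most \<open>2d\<close>. Deleting closed neighbourhoods of such vertices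
  greedily gives an independent set of size at least \<open>m / (2d + 1)\<close>, where \<open>m\<close> is the number of
  vertices. So if independent sets have at most \<open>\<alpha>\<close> elements, some vertex dominates at least
  \<open>m / (2\<alpha>)\<close> of the \<open>m\<close> vertices, itself included. Picking it into the dominating set costs one
  vertex and shrinks \<open>m\<close> by a factor of at most \<open>1 - 1/(2\<alpha>) \<le> exp (- 1/(2\<alpha>))\<close>, and once at most
  \<open>\<alpha>\<close> vertices remain undominated they are all taken.
\<close>

section \<open>Degrees and independent sets\<close>

text \<open>Double counting of the arcs of \<open>R\<close> inside \<open>W\<close>, grouped by head
  on the left and by tail on the right.\<close>

lemma sum_card_in_eq_sum_card_out:
  assumes "finite W"
  shows "(\<Sum>v\<in>W. card {u \<in> W. (u, v) \<in> R}) = (\<Sum>v\<in>W. card {u \<in> W. (v, u) \<in> R})"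
proof -
  have "(\<Sum>v\<in>W. card {u \<in> W. (u, v) \<in> R}) = (\<Sum>v\<in>W. \<Sum>u\<in>W. if (u, v) \<in> R then 1 else 0)"
    using assms by (simp add: sum.If_cases Int_def conj_commute)
  also have "\<dots> = (\<Sum>u\<in>W. \<Sum>v\<in>W. if (u, v) \<in> R then 1 else 0)"
    by (rule sum.swap)
  also have "\<dots> = (\<Sum>v\<in>W. card {u \<in> W. (v, u) \<in> R})"
    using assms by (simp add: sum.If_cases Int_def conj_commute)
  finally show ?thesis .
qed

lemma exists_small_in_degree:
  assumes "finite W" "W \<noteq> {}"
    and "\<And>v. v \<in> W \<Longrightarrow> card {u \<in> W. (v, u) \<in> R} \<le> d"
  obtains v where "v \<in> W" "card {u \<in> W. (u, v) \<in> R} \<le> d"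
proof -
  have "\<exists>v\<in>W. card {u \<in> W. (u, v) \<in> R} \<le> d"
  proof (rule ccontr)
    assume "\<not> ?thesis"
    then have "(\<Sum>v\<in>W. d) < (\<Sum>v\<in>W. card {u \<in> W. (u, v) \<in> R})"
      using assms by (intro sum_strict_mono) auto
    also have "\<dots> = (\<Sum>v\<in>W. card {u \<in> W. (v, u) \<in> R})"
      using assms(1) by (rule sum_card_in_eq_sum_card_out)
    also have "\<dots> \<le> (\<Sum>v\<in>W. d)"
      using assms(3) by (rule sum_mono)
    finally show False by simp
  qed
  then show ?thesis using that by blast
qed

text \<open>An out-degree bound passes to subsets, so the greedy deletion becomes an induction on
  \<open>W\<close>. The product form keeps the estimate in the naturals.\<close>

lemma exists_large_independent_subset:
  assumes "irrefl R" "finite W"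
    and "\<And>v. v \<in> W \<Longrightarrow> card {u \<in> W. (v, u) \<in> R} \<le> d"
  shows "\<exists>S\<subseteq>W. (\<forall>u\<in>S. \<forall>v\<in>S. (u, v) \<notin> R) \<and> card W \<le> (2 * d + 1) * card S"
  using assms(2,3)
proof (induction W rule: finite_psubset_induct)
  case (psubset W)
  show ?case
  proof (cases "W = {}")
    case False
    then obtain v where v: "v \<in> W" "card {u \<in> W. (u, v) \<in> R} \<le> d"
      using exists_small_in_degree[OF \<open>finite W\<close> _ psubset.prems] by blast
    \<comment> \<open>Neighbours in both directions go, so no vertex outside \<open>N\<close> is
      adjacent to \<open>v\<close>, and \<open>v\<close> can join the independent set found
      there.\<close>
    define N where "N = insert v ({u \<in> W. (v, u) \<in> R} \<union> {u \<in> W. (u, v) \<in> R})"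
    have N: "N \<subseteq> W" "v \<in> N" "finite N"
      using v(1) \<open>finite W\<close> by (auto simp: N_def)
    have "card N \<le> Suc (card ({u \<in> W. (v, u) \<in> R} \<union> {u \<in> W. (u, v) \<in> R}))"
      unfolding N_def by (rule card_insert_le_m1) auto
    also have "\<dots> \<le> Suc (card {u \<in> W. (v, u) \<in> R} + card {u \<in> W. (u, v) \<in> R})"
      by (simp add: card_Un_le)
    also have "\<dots> \<le> 2 * d + 1"
      using v psubset.prems[OF v(1)] by simp
    finally have card_N: "card N \<le> 2 * d + 1" .
    have deg: "card {u \<in> W - N. (w, u) \<in> R} \<le> d" if "w \<in> W - N" for w
    proof -
      have "card {u \<in> W - N. (w, u) \<in> R} \<le> card {u \<in> W. (w, u) \<in> R}"
        using \<open>finite W\<close> by (intro card_mono) auto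
      then show ?thesis using psubset.prems[of w] that by auto
    qed
    have "W - N \<subset> W" using v(1) N by auto
    from psubset.IH[OF this deg] obtain S
      where S: "S \<subseteq> W - N" "\<forall>u\<in>S. \<forall>v\<in>S. (u, v) \<notin> R" "card (W - N) \<le> (2 * d + 1) * card S"
      by blast
    have "finite S" "v \<notin> S"
      using S(1) N(2) \<open>finite W\<close> by (auto intro: finite_subset)
    have "\<forall>x\<in>insert v S. \<forall>y\<in>insert v S. (x, y) \<notin> R"
      using S \<open>irrefl R\<close> by (auto simp: N_def irrefl_def)
    moreover have "card W = card (W - N) + card N"
      using N \<open>finite W\<close> by (metis card_Diff_subset card_mono le_add_diff_inverse2)
    then have "card W \<le> (2 * d + 1) * card (insert v S)"
      using S(3) card_N \<open>finite S\<close> \<open>v \<notin> S\<close> by simp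
    moreover have "insert v S \<subseteq> W" using S v by auto
    ultimately show ?thesis by blast
  qed auto
qed

text \<open>A vertex of maximum out-degree works: with that degree as \<open>d\<close>, the greedy
  independent set has at most \<alpha> elements.\<close>

lemma exists_large_out_degree:
  assumes "irrefl R" "finite W" "W \<noteq> {}"
    and "\<And>S. S \<subseteq> W \<Longrightarrow> \<forall>u\<in>S. \<forall>v\<in>S. (u, v) \<notin> R \<Longrightarrow> card S \<le> \<alpha>"
  obtains v where "v \<in> W" "card W \<le> (2 * card {u \<in> W. (v, u) \<in> R} + 1) * \<alpha>"
proof -
  define deg where "deg v = card {u \<in> W. (v, u) \<in> R}" for v
  have "Max (deg ` W) \<in> deg ` W"
    using assms by (intro Max_in) auto
  then obtain v where v: "v \<in> W" "deg v = Max (deg ` W)"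
    by auto
  have "deg w \<le> deg v" if "w \<in> W" for w
    using v that assms(2) by simp
  then have "\<exists>S\<subseteq>W. (\<forall>x\<in>S. \<forall>y\<in>S. (x, y) \<notin> R) \<and> card W \<le> (2 * deg v + 1) * card S"
    using exists_large_independent_subset[OF assms(1,2), of "deg v"] by (simp add: deg_def)
  then have "card W \<le> (2 * deg v + 1) * \<alpha>"
    using assms(4) by (meson dual_order.trans mult_le_mono2)
  then show ?thesis using that v(1) by (simp add: deg_def)
qed

section \<open>Greedy domination\<close>

text \<open>\<open>W\<close> plays the role of the vertices still undominated. For
  \<open>0 < card W < \<alpha>\<close> the logarithm is negative and the formula falls below
  \<open>card W\<close>, hence the separate bound there, the cost of taking all of
  \<open>W\<close>.\<close>

lemma exists_small_dominating_subset:
  fixes \<alpha> :: nat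
  assumes "irrefl R" "finite W" "\<alpha> \<ge> 1"
    and "\<And>S. S \<subseteq> W \<Longrightarrow> \<forall>u\<in>S. \<forall>v\<in>S. (u, v) \<notin> R \<Longrightarrow> card S \<le> \<alpha>"
  shows "\<exists>S\<subseteq>W. (\<forall>u\<in>W - S. \<exists>v\<in>S. (v, u) \<in> R) \<and>
    real (card S) \<le> (if card W \<le> \<alpha> then real (card W)
                      else \<alpha> * (1 + 2 * ln (card W / \<alpha>)))"
  using assms(2,4)
proof (induction W rule: finite_psubset_induct)
  case (psubset W)
  show ?case
  proof (cases "card W \<le> \<alpha>")
    case True
    then show ?thesis by (intro exI[of _ W]) auto
  next
    case False
    then have "W \<noteq> {}" by auto
    then obtain v where v: "v \<in> W" "card W \<le> (2 * card {u \<in> W. (v, u) \<in> R} + 1) * \<alpha>"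
      using exists_large_out_degree[OF assms(1) \<open>finite W\<close> _ psubset.prems] by blast
    \<comment> \<open>Here only out-neighbours are removed: \<open>N\<close> is exactly what
      \<open>v\<close> dominates in \<open>W\<close>, itself included.\<close>
    define N where "N = insert v {u \<in> W. (v, u) \<in> R}"
    have N: "N \<subseteq> W" "v \<in> N" "finite N"
      using v(1) \<open>finite W\<close> by (auto simp: N_def)
    have card_N: "card N = card {u \<in> W. (v, u) \<in> R} + 1"
      using \<open>finite W\<close> \<open>irrefl R\<close> by (simp add: N_def irrefl_def)
    have card_W: "card W = card (W - N) + card N"
      using N \<open>finite W\<close> by (metis card_Diff_subset card_mono le_add_diff_inverse2)
    have "W - N \<subset> W" using v(1) N by auto
    moreover have "card S \<le> \<alpha>" if "S \<subseteq> W - N" "\<forall>u\<in>S. \<forall>v\<in>S. (u, v) \<notin> R" for S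
      using that by (intro psubset.prems) auto
    ultimately obtain S where S: "S \<subseteq> W - N"
      "\<forall>u\<in>W - N - S. \<exists>v\<in>S. (v, u) \<in> R"
      "real (card S) \<le> (if card (W - N) \<le> \<alpha> then real (card (W - N))
                      else \<alpha> * (1 + 2 * ln (card (W - N) / \<alpha>)))"
      using psubset.IH[of "W - N"] by blast
    have "finite S" "v \<notin> S"
      using S(1) N(2) \<open>finite W\<close> by (auto intro: finite_subset)
    then have card_S: "card (insert v S) = card S + 1" by simp
    have "\<forall>u\<in>W - insert v S. \<exists>x\<in>insert v S. (x, u) \<in> R"
      using S(2) by (auto simp: N_def)
    moreover have "insert v S \<subseteq> W" using S v by auto
    moreover have "real (card (insert v S)) \<le> \<alpha> * (1 + 2 * ln (card W / \<alpha>))"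
    \<comment> \<open>The strict inequality leaves room for \<open>v\<close> within \<alpha>. At
      \<open>card (W - N) = \<alpha>\<close> both bounds agree because \<open>ln 1 = 0\<close>, so
      the logarithmic one is available in the other case.\<close>
    proof (cases "card (W - N) < \<alpha>")
      case True
      then have "card (insert v S) \<le> \<alpha>" using S(3) card_S by simp
      moreover have "0 \<le> ln (card W / \<alpha>)"
        using False \<open>\<alpha> \<ge> 1\<close> by (intro ln_ge_zero) (simp add: field_simps)
      then have "real \<alpha> \<le> \<alpha> * (1 + 2 * ln (card W / \<alpha>))"
        by (simp add: algebra_simps)
      ultimately show ?thesis by linarith
    next
      case ge: False
      have pos: "real \<alpha> > 0" "real (card W) > 0" "real (card (W - N)) > 0"
        using ge False \<open>\<alpha> \<ge> 1\<close> by simp_all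
      \<comment> \<open>The factor \<open>2 * card N - 1\<close> is rounded up to
        \<open>2 * card N\<close>.\<close>
      have "card W \<le> 2 * \<alpha> * card N"
        using v(2) card_N by (simp add: algebra_simps)
      then have "real (card W) \<le> 2 * \<alpha> * card N"
        by (metis of_nat_le_iff of_nat_mult of_nat_numeral)
      \<comment> \<open>The left side equals \<open>- card N / card W\<close>; it is kept in the
        form \<open>x - 1\<close> for the inequality \<open>ln x \<le> x - 1\<close>.\<close>
      then have ratio: "card (W - N) / card W - 1 \<le> - 1 / (2 * real \<alpha>)"
        using pos card_W by (simp add: field_simps)
      have "real (card S) \<le> \<alpha> * (1 + 2 * ln (card (W - N) / \<alpha>))"
        using S(3) ge pos by (auto split: if_splits)
      also have "ln (card (W - N) / \<alpha>) = ln (card W / \<alpha>) + ln (card (W - N) / card W)"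
        using pos by (simp add: ln_div)
      also have "ln (card (W - N) / card W) \<le> - 1 / (2 * real \<alpha>)"
        using ln_le_minus_one[of "card (W - N) / card W"] ratio pos by simp
      finally have "real (card S) \<le> \<alpha> * (1 + 2 * (ln (card W / \<alpha>) + - 1 / (2 * real \<alpha>)))"
        using pos by simp
      \<comment> \<open>The coefficient \<open>2 * \<alpha>\<close> of the logarithm turns the
        decrease \<open>1 / (2 * \<alpha>)\<close> into exactly 1, which pays for
        \<open>v\<close>.\<close>
      also have "\<dots> = \<alpha> * (1 + 2 * ln (card W / \<alpha>)) - 1"
        using pos by (simp add: field_simps)
      finally show ?thesis using card_S by simp
    qed
    ultimately show ?thesis using False by (intro exI[of _ "insert v S"]) simp
  qed
qed

section \<open>Extrema over finite sets and orientations\<close>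

lemma card_le_independence_number:
  assumes "finite (pverts G)" "independent_set G S"
  shows "card S \<le> independence_number G"
  unfolding independence_number_def
proof (rule Max_ge)
  have "{card S |S. independent_set G S} \<subseteq> card ` Pow (pverts G)"
    by (auto simp: independent_set_def)
  then show "finite {card S |S. independent_set G S}"
    using assms(1) by (meson finite_Pow_iff finite_imageI finite_subset)
qed (use assms in auto)

lemma directed_domination_number_le_card:
  assumes "finite (pverts D)" "directed_dominating_set D S"
  shows "directed_domination_number D \<le> card S"
  unfolding directed_domination_number_def
proof (rule Min_le)
  have "{card S |S. directed_dominating_set D S} \<subseteq> card ` Pow (pverts D)"
    by (auto simp: directed_dominating_set_def)
  then show "finite {card S |S. directed_dominating_set D S}"
    using assms(1) by (meson finite_Pow_iff finite_imageI finite_subset)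
qed (use assms in auto)

text \<open>An orientation is determined by its arc set, a subset of \<open>parcs G\<close>.\<close>

lemma finite_orientations:
  assumes "finite (parcs G)"
  shows "finite {D. orientation G D}"
proof (rule finite_subset)
  show "{D. orientation G D} \<subseteq>
      (\<lambda>A. \<lparr>pverts = pverts G, parcs = A\<rparr>) ` Pow (parcs G)"
  proof
    fix D assume "D \<in> {D. orientation G D}"
    then have "D = \<lparr>pverts = pverts G, parcs = parcs D\<rparr>" "parcs D \<in> Pow (parcs G)"
      by (auto simp: orientation_def)
    then show "D \<in> (\<lambda>A. \<lparr>pverts = pverts G, parcs = A\<rparr>) ` Pow (parcs G)"
      by (rule image_eqI)
  qed
qed (use assms in simp)

text \<open>Number the vertices injectively and direct each edge towards the larger number. This
  makes the set under \<open>Max\<close> nonempty.\<close>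

lemma orientation_exists:
  assumes "pair_graph G"
  shows "\<exists>D. orientation G D"
proof -
  interpret pair_graph G by fact
  obtain f :: "'a \<Rightarrow> nat" where f: "inj_on f (pverts G)"
    using finite_imp_inj_to_nat_seg[OF finite_verts] by auto
  have ends: "u \<in> pverts G" "v \<in> pverts G" "(v, u) \<in> parcs G" "u \<noteq> v"
    if "(u, v) \<in> parcs G" for u v
    using in_arcsD1[OF that] in_arcsD2[OF that] arcs_symmetric[OF that] no_loops'[OF that]
    by simp_all
  have "orientation G \<lparr>pverts = pverts G, parcs = {(u, v) \<in> parcs G. f u < f v}\<rparr>"
    unfolding orientation_def
  proof (intro conjI ballI, goal_cases)
    case (3 e)
    obtain u v where e: "e = (u, v)" by fastforce
    have uv: "(u, v) \<in> parcs G" using 3 e by simp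
    then have "f u \<noteq> f v" using f ends[OF uv] by (metis inj_onD)
    then show ?case using ends[OF uv] uv e by auto
  qed auto
  then show ?thesis by blast
qed

text \<open>Reduces the theorem to a single orientation \<open>D\<close>.\<close>

lemma upper_directed_domination_number_attained:
  assumes "pair_graph G"
  obtains D where "orientation G D"
    "upper_directed_domination_number G = directed_domination_number D"
proof -
  interpret pair_graph G by fact
  have "finite {directed_domination_number D |D. orientation G D}"
    using finite_orientations[OF finite_arcs] by (simp add: setcompr_eq_image)
  moreover have "{directed_domination_number D |D. orientation G D} \<noteq> {}"
    using orientation_exists[OF assms] by auto
  ultimately have "upper_directed_domination_number G \<in>
      {directed_domination_number D |D. orientation G D}"
    unfolding upper_directed_domination_number_def by (rule Max_in)
  then show ?thesis using that by blast
qed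

theorem theorem2p3:
  fixes G :: "'a pair_pre_digraph" and \<alpha> n :: nat
  assumes "pair_graph G"
    and "\<alpha> \<ge> 1"
    and "independence_number G \<le> \<alpha>"
    and "n = card (pverts G)"
    and "n \<ge> \<alpha>"
  shows "real (upper_directed_domination_number G)
           \<le> real \<alpha> * (1 + 2 * ln (real n / real \<alpha>))"
proof -
  interpret pair_graph G by fact
  have fin: "finite (pverts G)" using finite_verts by simp
  obtain D where D: "orientation G D"
    and eq: "upper_directed_domination_number G = directed_domination_number D"
    using upper_directed_domination_number_attained[OF assms(1)] .
  have "irrefl (parcs D)"
    using D no_loops' by (auto simp: orientation_def irrefl_def)
  moreover have "card S \<le> \<alpha>"
    if "S \<subseteq> pverts G" "\<forall>u\<in>S. \<forall>v\<in>S. (u, v) \<notin> parcs D" for S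
  proof -
    \<comment> \<open>Every edge of \<open>G\<close> survives in one direction, so a set free of
      arcs of \<open>D\<close> is independent in \<open>G\<close>.\<close>
    have "(u, v) \<in> parcs D \<or> (v, u) \<in> parcs D" if "(u, v) \<in> parcs G" for u v
      using D that unfolding orientation_def by blast
    with that have "independent_set G S"
      unfolding independent_set_def by blast
    then show ?thesis
      using card_le_independence_number[OF fin] assms(3) by (meson le_trans)
  qed
  ultimately obtain S where S: "S \<subseteq> pverts G" "\<forall>u\<in>pverts G - S. \<exists>v\<in>S. (v, u) \<in> parcs D"
    "real (card S) \<le> (if card (pverts G) \<le> \<alpha> then real (card (pverts G))
                      else \<alpha> * (1 + 2 * ln (card (pverts G) / \<alpha>)))"
    using exists_small_dominating_subset[OF _ fin assms(2), of "parcs D"] by blast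
  have "directed_domination_number D \<le> card S"
    using S D fin
    by (intro directed_domination_number_le_card)
      (auto simp: directed_dominating_set_def orientation_def)
  \<comment> \<open>Since \<open>n \<ge> \<alpha>\<close>, the first branch occurs only for
    \<open>n = \<alpha>\<close>, where the logarithm vanishes and both bounds equal
    \<alpha>.\<close>
  moreover have "real (card S) \<le> \<alpha> * (1 + 2 * ln (n / \<alpha>))"
    using S(3) assms(2,4,5) by (auto split: if_splits)
  ultimately show ?thesis using eq by linarith
qed

end
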